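(* Let $\Pi=\Pi(\mu,\nu)\subset\mathbb{R}^m$ be a coordinate parallelepiped of dimension $m$. The $L$-classes of reduced faces of $\Pi$ (each identified with the union of the faces it contains) form a simplicial cell complex combinatorially equivalent to the standard simplex. More precisely: (1) any $L$-class is homeomorphic to a closed disk; (2) there is a one-to-one correspondence between $L$-classes and the faces of a simplex such that corresponding sets are homeomorphic, and intersections correspond to intersections.
   Context: Let $\mu_k<\nu_k$ be integers for $k=1,\dots,m$, and $\Pi=\Pi(\mu,\nu)=\{y\in\mathbb{R}^m:\mu_k\le y_k\le\nu_k,\ k=1,\dots,m\}$. The paradiagram of a point $y\in\Pi$ is the $m$-tuple $(\tilde y_1,\dots,\tilde y_m)$ with $\tilde y_i=0$ if $y_i=\mu_i$, $\tilde y_i=1$ if $y_i=\nu_i$, and $\tilde y_i=*$ otherwise. All points of the relative interior of a face $F$ have the same paradiagram, called the paradiagram of $F$. A paradiagram (and the corresponding face) is reduced if $1$ is never immediately followed by $0$ in it. Two reduced faces $F_1,F_2$ of the same dimension are related by an $L$-move if $F_1\cap F_2$ is a non-reduced facet of both $F_1$ and $F_2$ (equivalently, the paradiagram of one is obtained from that of the other by replacing a single string $*0$ of consecutive entries by $1*$). Two reduced faces of the same dimension are $L$-equivalent if one is obtained from the other by a sequence of $L$-moves and inverse $L$-moves. $L$-classes are the $L$-equivalence classes of reduced faces; an $L$-class is identified with the union of its faces, as a subset of $\Pi$. In the correspondence, faces of the simplex are nonempty faces, with the empty intersection corresponding to the empty intersection. *)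

theory Defs
  imports "HOL-Analysis.Analysis"
begin

text \<open>
  The ambient space R^m is \<^typ>\<open>real ^ 'n\<close>, where the index type is a finite linear order with
  m elements, standing for the ordered index set {1, ..., m}.
\<close>

definition parallelepiped :: "int ^ 'n \<Rightarrow> int ^ 'n \<Rightarrow> (real ^ 'n) set" where
  "parallelepiped \<mu> \<nu> = {y. \<forall>k. of_int (\<mu> $ k) \<le> y $ k \<and> y $ k \<le> of_int (\<nu> $ k)}"

datatype symbol = Zero | One | Star

definition paradiagram :: "int ^ 'n \<Rightarrow> int ^ 'n \<Rightarrow> real ^ 'n \<Rightarrow> 'n \<Rightarrow> symbol" where
  "paradiagram \<mu> \<nu> y i =
     (if y $ i = of_int (\<mu> $ i) then Zero
      else if y $ i = of_int (\<nu> $ i) then One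
      else Star)"

text \<open>
  Meaningful for nonempty faces \<^term>\<open>F\<close> of the parallelepiped: all points of the relative
  interior of such a face have the same paradiagram.
\<close>

definition face_paradiagram ::
    "int ^ 'n \<Rightarrow> int ^ 'n \<Rightarrow> (real ^ 'n) set \<Rightarrow> 'n \<Rightarrow> symbol" where
  "face_paradiagram \<mu> \<nu> F = (THE p. \<forall>y \<in> rel_interior F. paradiagram \<mu> \<nu> y = p)"

definition consecutive :: "'n::linorder \<Rightarrow> 'n \<Rightarrow> bool" where
  "consecutive i j \<longleftrightarrow> i < j \<and> \<not> (\<exists>k. i < k \<and> k < j)"

definition reduced_paradiagram :: "('n::linorder \<Rightarrow> symbol) \<Rightarrow> bool" where
  "reduced_paradiagram p \<longleftrightarrow> \<not> (\<exists>i j. consecutive i j \<and> p i = One \<and> p j = Zero)"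

definition nonempty_faces :: "'a::real_vector set \<Rightarrow> 'a set set" where
  "nonempty_faces P = {F. F face_of P \<and> F \<noteq> {}}"

definition reduced_faces ::
    "(int, 'n::{finite,linorder}) vec \<Rightarrow> (int, 'n) vec \<Rightarrow> (real, 'n) vec set set" where
  "reduced_faces \<mu> \<nu> =
     {F \<in> nonempty_faces (parallelepiped \<mu> \<nu>). reduced_paradiagram (face_paradiagram \<mu> \<nu> F)}"

text \<open>This relation is symmetric, so it covers L-moves together with their inverses.\<close>

definition L_move ::
    "(int, 'n::{finite,linorder}) vec \<Rightarrow> (int, 'n) vec \<Rightarrow> (real, 'n) vec set \<Rightarrow> (real, 'n) vec set \<Rightarrow> bool" where
  "L_move \<mu> \<nu> F G \<longleftrightarrow>
     F \<in> reduced_faces \<mu> \<nu> \<and> G \<in> reduced_faces \<mu> \<nu> \<and> aff_dim F = aff_dim G \<and>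
     (F \<inter> G) facet_of F \<and> (F \<inter> G) facet_of G \<and>
     \<not> reduced_paradiagram (face_paradiagram \<mu> \<nu> (F \<inter> G))"

definition L_equivalence ::
    "(int, 'n::{finite,linorder}) vec \<Rightarrow> (int, 'n) vec \<Rightarrow> ((real, 'n) vec set \<times> (real, 'n) vec set) set" where
  "L_equivalence \<mu> \<nu> =
     {(F, G). F \<in> reduced_faces \<mu> \<nu> \<and> G \<in> reduced_faces \<mu> \<nu> \<and> equivclp (L_move \<mu> \<nu>) F G}"

text \<open>
  An L-class is kept as a set of faces; the subset of the parallelepiped it is identified with is
  \<^term>\<open>\<Union>C\<close>.
\<close>

definition L_classes ::
    "(int, 'n::{finite,linorder}) vec \<Rightarrow> (int, 'n) vec \<Rightarrow> (real, 'n) vec set set set" where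
  "L_classes \<mu> \<nu> = reduced_faces \<mu> \<nu> // L_equivalence \<mu> \<nu>"

text \<open>
  Homeomorphic to the closed unit disk of R^d, the latter realized as a d-dimensional linear
  subspace \<^term>\<open>V\<close> of the ambient Euclidean space.
\<close>

definition homeomorphic_to_disk :: "nat \<Rightarrow> 'a::euclidean_space set \<Rightarrow> bool" where
  "homeomorphic_to_disk d A \<longleftrightarrow>
     (\<exists>V :: 'a set. subspace V \<and> dim V = d \<and> A homeomorphic (cball 0 1 \<inter> V))"

text \<open>
  The simplex with vertex set \<^typ>\<open>'k\<close>; over \<^typ>\<open>'n option\<close>, which has one element more than
  \<^typ>\<open>'n\<close>, it has dimension m.
\<close>

definition standard_simplex :: "(real ^ 'k) set" where
  "standard_simplex = convex hull (range (\<lambda>i. axis i 1))"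

end

theory Submission
  imports Defs
begin

text \<open>
  Number the \<open>m + 1\<close> vertices of the simplex by \<open>0, \<dots>, m\<close>, where \<open>None\<close> stands for 0, and let
  \<open>X\<^sub>i\<close> be the set of points \<open>y\<close> of the parallelepiped with \<open>y\<^sub>i = \<nu>\<^sub>i\<close> or \<open>y\<^sub>i\<^sub>+\<^sub>1 = \<mu>\<^sub>i\<^sub>+\<^sub>1\<close> (the first
  alternative being void for \<open>i = 0\<close>, the second for \<open>i = m\<close>). The support of a paradiagram is the
  set of those \<open>i\<close> for which the corresponding face is not contained in \<open>X\<^sub>i\<close>. It is invariant under
  L-moves, and sliding every \<open>*0\<close> to \<open>1*\<close> leads to a normal form determined by the support, so the
  L-classes correspond to the nonempty sets \<open>S\<close> of vertices. The union of the class of \<open>S\<close> is the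
  intersection of the \<open>X\<^sub>i\<close> with \<open>i \<notin> S\<close>, whence intersections correspond to intersections. Moreover
  \<open>S\<close> cuts the coordinates into blocks, and the union of the class is a product of monotone edge
  paths, one in each block, which the sum of the coordinates in the block maps homeomorphically
  onto an interval.
\<close>

section \<open>Coordinate boxes\<close>

text \<open>The criterion is that every segment from a point of the box to \<open>x\<close> extends
  a little beyond \<open>x\<close> inside the box. Tested on the two corners, it gives the strict
  inequalities.\<close>

lemma rel_interior_cbox_cart:
  fixes a b :: "real ^ 'n"
  assumes le: "\<And>k. a $ k \<le> b $ k"
  shows "rel_interior (cbox a b) =
    {x \<in> cbox a b. \<forall>k. a $ k < b $ k \<longrightarrow> a $ k < x $ k \<and> x $ k < b $ k}"
proof -
  have ne: "a \<in> cbox a b" "b \<in> cbox a b"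
    using le by (auto simp: mem_box_cart)
  have iff: "x \<in> rel_interior (cbox a b) \<longleftrightarrow>
      (\<forall>y\<in>cbox a b. \<exists>e>1. (1 - e) *\<^sub>R y + e *\<^sub>R x \<in> cbox a b)" for x
    using convex_rel_interior_iff[of "cbox a b" x] ne by auto
  show ?thesis
  proof (intro set_eqI iffI)
    fix x assume x: "x \<in> rel_interior (cbox a b)"
    have "a $ k < x $ k \<and> x $ k < b $ k" if "a $ k < b $ k" for k
    proof -
      obtain e where e: "e > 1" "(1 - e) *\<^sub>R a + e *\<^sub>R x \<in> cbox a b"
        using x ne iff by blast
      then have "(1 - e) * a $ k + e * x $ k \<le> b $ k" by (auto simp: mem_box_cart)
      then have "e * x $ k \<le> b $ k + (e - 1) * a $ k" by (simp add: algebra_simps)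
      also have "\<dots> < e * b $ k"
        using mult_strict_left_mono[OF that, of "e - 1"] e by (simp add: algebra_simps)
      finally have 1: "x $ k < b $ k" using e by simp
      obtain e where e: "e > 1" "(1 - e) *\<^sub>R b + e *\<^sub>R x \<in> cbox a b"
        using x ne iff by blast
      then have "(1 - e) * b $ k + e * x $ k \<ge> a $ k" by (auto simp: mem_box_cart)
      then have "e * x $ k \<ge> a $ k + (e - 1) * b $ k" by (simp add: algebra_simps)
      moreover have "a $ k + (e - 1) * b $ k > e * a $ k"
        using mult_strict_left_mono[OF that, of "e - 1"] e by (simp add: algebra_simps)
      ultimately have "e * a $ k < e * x $ k" by linarith
      then have "a $ k < x $ k" using e by simp
      with 1 show ?thesis by simp
    qed
    moreover have "x \<in> cbox a b" using x rel_interior_subset by blast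
    ultimately show "x \<in> {x \<in> cbox a b. \<forall>k. a $ k < b $ k \<longrightarrow> a $ k < x $ k \<and> x $ k < b $ k}"
      by blast
  next
    fix x assume x: "x \<in> {x \<in> cbox a b. \<forall>k. a $ k < b $ k \<longrightarrow> a $ k < x $ k \<and> x $ k < b $ k}"
    have "\<exists>e>1. (1 - e) *\<^sub>R y + e *\<^sub>R x \<in> cbox a b" if y: "y \<in> cbox a b" for y
    proof -
      let ?g = "\<lambda>k e. (1 - e) * y $ k + e * x $ k"
      \<comment> \<open>Strict inequalities at \<open>e = 1\<close> persist for \<open>e\<close>
        slightly above 1, and in a degenerate coordinate the expression is constant. As there are
        finitely many coordinates, one \<open>e\<close> serves all.\<close>
      have "eventually (\<lambda>e. a $ k \<le> ?g k e \<and> ?g k e \<le> b $ k) (at_right 1)" for k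
      proof (cases "a $ k < b $ k")
        case True
        have t: "(?g k \<longlongrightarrow> (1 - 1) * y $ k + 1 * x $ k) (at_right 1)"
          by (intro tendsto_intros)
        have "eventually (\<lambda>e. a $ k < ?g k e) (at_right 1)"
          using order_tendstoD(1)[OF t] True x by auto
        moreover have "eventually (\<lambda>e. ?g k e < b $ k) (at_right 1)"
          using order_tendstoD(2)[OF t] True x by auto
        ultimately show ?thesis by eventually_elim auto
      next
        case False
        then have "a $ k = b $ k" using le[of k] by simp
        then have "x $ k = a $ k" "y $ k = a $ k" "b $ k = a $ k"
          using x y by (auto simp: mem_box_cart intro!: antisym) (metis+)
        then show ?thesis by (simp add: algebra_simps)
      qed
      then have "eventually (\<lambda>e. \<forall>k. a $ k \<le> ?g k e \<and> ?g k e \<le> b $ k) (at_right 1)"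
        by (rule eventually_all_finite)
      then have "eventually (\<lambda>e. 1 < e \<and> (\<forall>k. a $ k \<le> ?g k e \<and> ?g k e \<le> b $ k)) (at_right 1)"
        by (intro eventually_conj eventually_at_right_less)
      then obtain e where "1 < e" "\<forall>k. a $ k \<le> ?g k e \<and> ?g k e \<le> b $ k"
        using eventually_happens'[OF trivial_limit_at_right_real] by fast
      then show ?thesis by (auto simp: mem_box_cart intro!: exI[of _ e])
    qed
    then show "x \<in> rel_interior (cbox a b)" using iff by blast
  qed
qed

text \<open>The box is squeezed between the affine space \<open>A\<close> through \<open>a\<close>
  in the nondegenerate directions and the relatively open piece \<open>A \<inter> T\<close>, which
  has the same dimension.\<close>

lemma aff_dim_cbox_cart:
  fixes a b :: "real ^ 'n"
  assumes le: "\<And>k. a $ k \<le> b $ k"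
  shows "aff_dim (cbox a b) = int (card {k. a $ k < b $ k})"
proof -
  let ?d = "{k. a $ k < b $ k}"
  define W :: "(real ^ 'n) set" where "W = {x. \<forall>i. i \<notin> ?d \<longrightarrow> x $ i = 0}"
  define A where "A = (+) a ` W"
  define T where "T = (\<Inter>k\<in>?d. {x. a $ k < x $ k \<and> x $ k < b $ k})"
  have W: "subspace W" by (auto simp: W_def subspace_def)
  have "dim W = card ?d"
    unfolding W_def dim_vec_eq[symmetric] by (rule dim_substandard_cart)
  then have A: "aff_dim A = int (card ?d)"
    using W by (simp add: A_def aff_dim_translation_eq aff_dim_subspace)
  have memA: "x \<in> A \<longleftrightarrow> (\<forall>i. i \<notin> ?d \<longrightarrow> x $ i = a $ i)" for x
  proof
    assume "\<forall>i. i \<notin> ?d \<longrightarrow> x $ i = a $ i"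
    then have "x - a \<in> W" by (simp add: W_def)
    moreover have "x = a + (x - a)" by simp
    ultimately show "x \<in> A" unfolding A_def by blast
  qed (auto simp: A_def W_def)
  have "convex A" unfolding A_def
    using W subspace_imp_convex convex_translation by blast
  moreover have "open T" unfolding T_def
    by (intro open_INT ballI open_Collect_conj open_Collect_less continuous_intros) simp
  \<comment> \<open>The centre of the box witnesses that the open piece is nonempty.\<close>
  moreover have "(\<chi> k. (a $ k + b $ k) / 2) \<in> A \<inter> T"
    using le by (auto simp: memA T_def intro: antisym)
  ultimately have AT: "aff_dim (A \<inter> T) = aff_dim A"
    by (intro aff_dim_convex_Int_open) auto
  have "A \<inter> T \<subseteq> cbox a b"
  proof
    fix x assume x: "x \<in> A \<inter> T"
    have "a $ k \<le> x $ k \<and> x $ k \<le> b $ k" for k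
      using x le[of k] by (cases "k \<in> ?d") (auto simp: memA T_def intro: less_imp_le)
    then show "x \<in> cbox a b" by (simp add: mem_box_cart)
  qed
  moreover have "cbox a b \<subseteq> A"
  proof
    fix x assume x: "x \<in> cbox a b"
    have "x $ i = a $ i" if "i \<notin> ?d" for i
      using x that by (auto simp: mem_box_cart not_less intro!: antisym) (metis order_trans)
    then show "x \<in> A" by (simp add: memA)
  qed
  ultimately show ?thesis
    using aff_dim_subset[of "A \<inter> T" "cbox a b"] aff_dim_subset[of "cbox a b" A] AT A by linarith
qed

text \<open>If a convex combination with positive weights attains an extreme value of a coordinate,
  then both endpoints attain it.\<close>

lemma cbox_cart_face_of:
  fixes a b c d :: "real ^ 'n"
  assumes "\<And>k. c $ k = a $ k \<and> d $ k = b $ k \<or> c $ k = a $ k \<and> d $ k = a $ k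
     \<or> c $ k = b $ k \<and> d $ k = b $ k"
    and le: "\<And>k. a $ k \<le> b $ k"
  shows "cbox c d face_of cbox a b"
  unfolding face_of_def
proof (intro conjI ballI impI convex_box)
  have cd: "a $ k \<le> c $ k" "d $ k \<le> b $ k" for k
    using assms(1)[of k] le[of k] by auto
  show "cbox c d \<subseteq> cbox a b"
    using cd by (fastforce simp: mem_box_cart intro: order_trans)
  fix u v x assume u: "u \<in> cbox a b" and v: "v \<in> cbox a b" and x: "x \<in> cbox c d"
    and "x \<in> open_segment u v"
  then obtain t where t: "0 < t" "t < 1" "x = (1 - t) *\<^sub>R u + t *\<^sub>R v"
    by (auto simp: in_segment)
  have bd: "a $ k \<le> u $ k" "u $ k \<le> b $ k" "a $ k \<le> v $ k" "v $ k \<le> b $ k" for k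
    using u v by (auto simp: mem_box_cart)
  have "(c $ k \<le> u $ k \<and> u $ k \<le> d $ k) \<and> (c $ k \<le> v $ k \<and> v $ k \<le> d $ k)" for k
  proof -
    have xk: "c $ k \<le> x $ k" "x $ k \<le> d $ k" using x by (auto simp: mem_box_cart)
    have split: "x $ k - z = (1 - t) * (u $ k - z) + t * (v $ k - z)" for z
      by (simp add: t(3) algebra_simps)
    consider "c $ k = a $ k \<and> d $ k = b $ k" | "c $ k = a $ k \<and> d $ k = a $ k"
      | "c $ k = b $ k \<and> d $ k = b $ k" using assms(1) by blast
    then show ?thesis
    proof cases
      case 1 then show ?thesis using bd by auto
    next
      case 2
      have "0 \<le> (1 - t) * (u $ k - a $ k)" "0 \<le> t * (v $ k - a $ k)"
        using t bd[of k] by auto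
      then have "(1 - t) * (u $ k - a $ k) = 0" "t * (v $ k - a $ k) = 0"
        using split[of "a $ k"] xk 2 by linarith+
      then show ?thesis using t 2 by auto
    next
      case 3
      have "(1 - t) * (u $ k - b $ k) \<le> 0" "t * (v $ k - b $ k) \<le> 0"
        using t bd[of k] by (auto simp: mult_le_0_iff)
      then have "(1 - t) * (u $ k - b $ k) = 0" "t * (v $ k - b $ k) = 0"
        using split[of "b $ k"] xk 3 by linarith+
      then show ?thesis using t 3 by auto
    qed
  qed
  then show "u \<in> cbox c d" "v \<in> cbox c d" by (auto simp: mem_box_cart)
qed

section \<open>Paradiagrams\<close>

lemma consecutive_right_unique: "consecutive i j \<Longrightarrow> consecutive i k \<Longrightarrow> j = k"
  unfolding consecutive_def by (meson linorder_neqE)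

lemma consecutive_left_unique: "consecutive i j \<Longrightarrow> consecutive k j \<Longrightarrow> i = k"
  unfolding consecutive_def by (meson linorder_neqE)

lemma consecutive_less: "consecutive i j \<Longrightarrow> i < j"
  by (simp add: consecutive_def)

lemma obtain_next:
  fixes i j :: "'n::{finite,linorder}"
  assumes "i < j"
  obtains k where "consecutive i k" "k \<le> j"
proof
  have "Min {i<..} \<in> {i<..}" using assms by (intro Min_in) auto
  then show "consecutive i (Min {i<..})"
    unfolding consecutive_def by (auto dest: Min_le[OF finite, of _ "{i<..}", unfolded greaterThan_iff, THEN leD])
  show "Min {i<..} \<le> j" using assms by simp
qed

lemma Min_UNIV_le: "Min UNIV \<le> (j :: 'n::{finite,linorder})"
  by (rule Min_le) auto

lemma not_consecutive_Min [simp]: "\<not> consecutive i (Min UNIV :: 'n::{finite,linorder})"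
  using Min_UNIV_le[of i] by (auto simp: consecutive_def)

section \<open>Supports of paradiagrams\<close>

definition support :: "('n::{finite,linorder} \<Rightarrow> symbol) \<Rightarrow> 'n option set" where
  "support p = {s. case s of
      None \<Rightarrow> p (Min UNIV) \<noteq> Zero
    | Some k \<Rightarrow> p k \<noteq> One \<and> (\<forall>j. consecutive k j \<longrightarrow> p j \<noteq> Zero)}"

lemma None_in_support [simp]: "None \<in> support p \<longleftrightarrow> p (Min UNIV) \<noteq> Zero"
  and Some_in_support [simp]:
    "Some k \<in> support p \<longleftrightarrow> p k \<noteq> One \<and> (\<forall>j. consecutive k j \<longrightarrow> p j \<noteq> Zero)"
  by (auto simp: support_def)

text \<open>If \<open>P k\<close> failed, the greatest index between \<open>i\<close> and
  \<open>k\<close> satisfying \<open>P\<close> would have a successor in that range, which would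
  satisfy \<open>P\<close> too.\<close>

lemma consecutive_induct [consumes 1, case_names base step]:
  fixes i k :: "'n::{finite,linorder}"
  assumes "i \<le> k" "P i"
    and step: "\<And>j l. consecutive j l \<Longrightarrow> i \<le> j \<Longrightarrow> l \<le> k \<Longrightarrow> P j \<Longrightarrow> P l"
  shows "P k"
proof (rule ccontr)
  assume "\<not> P k"
  define A where "A = {j. i \<le> j \<and> j \<le> k \<and> P j}"
  define m where "m = Max A"
  have "m \<in> A" unfolding m_def using assms by (intro Max_in) (auto simp: A_def)
  then have m: "i \<le> m" "m \<le> k" "P m" by (auto simp: A_def)
  with \<open>\<not> P k\<close> have "m < k" by (metis order_le_less)
  then obtain l where l: "consecutive m l" "l \<le> k" by (rule obtain_next)
  have "m < l" using l(1) by (rule consecutive_less)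
  have "P l" using step l m by blast
  then have "l \<in> A" using m(1) \<open>m < l\<close> l(2) by (simp add: A_def)
  then have "l \<le> m" unfolding m_def by (intro Max_ge) auto
  with \<open>m < l\<close> show False by simp
qed

lemma zero_prefix:
  fixes p :: "'n::{finite,linorder} \<Rightarrow> symbol"
  assumes "p (Min UNIV) = Zero" "\<And>i j. consecutive i j \<Longrightarrow> j \<le> k \<Longrightarrow> p i = Zero \<Longrightarrow> p j = Zero"
  shows "p k = Zero"
  using Min_UNIV_le[of k] by (induction rule: consecutive_induct) (use assms in blast)+

text \<open>The sets \<open>X\<^sub>i\<close> have no common point: without \<open>None\<close> the
  first entry is Zero, without the other vertices Zero passes on to each successor, and a Zero in
  the last entry puts the last vertex into the support.\<close>

lemma support_nonempty: "support p \<noteq> {}"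
proof
  assume e: "support p = {}"
  have "p k = Zero" for k
  proof (rule zero_prefix)
    show "p (Min UNIV) = Zero" using e None_in_support[of p] by blast
    fix i j assume "consecutive i j" "p i = Zero"
    then show "p j = Zero"
      using e Some_in_support[of i p] consecutive_right_unique by fastforce
  qed
  moreover have "\<not> consecutive (Max UNIV) j" for j :: 'a
    using Max_ge[of UNIV j] by (auto simp: consecutive_def simp del: Max_ge)
  ultimately have "Some (Max UNIV) \<in> support p" by simp
  with e show False by simp
qed

text \<open>The two faces meeting in a non-reduced facet both have the support of that facet.\<close>

lemma support_fun_upd_Star:
  assumes ab: "consecutive a b" and r: "r a = One" "r b = Zero"
  shows "support (r(a := Star)) = support r" "support (r(b := Star)) = support r"
proof -
  have "a < b" using ab by (rule consecutive_less)
  then have b: "b \<noteq> Min UNIV" using Min_UNIV_le[of a] by auto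
  have "s \<in> support (r(a := Star)) \<longleftrightarrow> s \<in> support r" for s
    using ab r \<open>a < b\<close> by (cases s) (auto, metis symbol.distinct(1))
  then show "support (r(a := Star)) = support r" by blast
  have "s \<in> support (r(b := Star)) \<longleftrightarrow> s \<in> support r" for s
    using ab r \<open>a < b\<close> b by (cases s) (auto dest: consecutive_left_unique)
  then show "support (r(b := Star)) = support r" by blast
qed

text \<open>The combinatorial form of inclusion of faces (see \<open>face_subset_iff\<close>), used
  also for a point lying in a face.\<close>

definition refines :: "('n \<Rightarrow> symbol) \<Rightarrow> ('n \<Rightarrow> symbol) \<Rightarrow> bool" where
  "refines p q \<longleftrightarrow> (\<forall>k. q k \<noteq> Star \<longrightarrow> p k = q k)"

lemma refines_fun_upd_Star:
  "refines p (r(a := Star)) \<longleftrightarrow> (\<forall>k. k \<noteq> a \<longrightarrow> r k \<noteq> Star \<longrightarrow> p k = r k)"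
  by (auto simp: refines_def)

lemma support_mono: "refines p q \<Longrightarrow> support p \<subseteq> support q"
proof
  fix s assume r: "refines p q" and s: "s \<in> support p"
  have "q k = Zero \<Longrightarrow> p k = Zero" "q k = One \<Longrightarrow> p k = One" for k
    using r by (auto simp: refines_def)
  with s show "s \<in> support q" by (cases s) auto
qed

lemma card_non_Star_less:
  fixes r :: "'n::finite \<Rightarrow> symbol"
  assumes "r k \<noteq> Star"
  shows "card {i. (r(k := Star)) i \<noteq> Star} < card {i. r i \<noteq> Star}"
  using assms by (intro psubset_card_mono) auto

text \<open>Entries are freed one at a time: the One of a string \<open>10\<close>, which keeps the
  support, or, in a reduced paradiagram, an entry that blocks a missing vertex of \<open>S\<close>.
  The number of fixed entries decreases. For the paradiagram of a point this yields a face of the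
  class of \<open>S\<close> through that point.\<close>

lemma ex_reduced_coarsening:
  assumes "support r \<subseteq> S"
  shows "\<exists>p. reduced_paradiagram p \<and> support p = S \<and> refines r p"
  using assms
proof (induction "card {k. r k \<noteq> Star}" arbitrary: r rule: less_induct)
  case less
  have IH: ?case if k: "support (r(k := Star)) \<subseteq> S" "r k \<noteq> Star" for k
  proof -
    obtain p where "reduced_paradiagram p" "support p = S" "refines (r(k := Star)) p"
      using less.hyps[OF card_non_Star_less[of r k]] k by blast
    then show ?thesis
      by (intro exI[of _ p]) (auto simp: refines_def split: if_splits)
  qed
  show ?case
  proof (cases "reduced_paradiagram r")
    case False
    then obtain a b where "consecutive a b" "r a = One" "r b = Zero"
      by (auto simp: reduced_paradiagram_def)
    then show ?thesis using support_fun_upd_Star(1)[of a b r] less.prems by (intro IH[of a]) auto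
  next
    case red: True
    show ?thesis
    proof (cases "support r = S")
      case True
      with red show ?thesis by (auto simp: refines_def)
    next
      case False
      then obtain s where s: "s \<in> S" "s \<notin> support r" using less.prems by blast
      \<comment> \<open>The entry to free is the one that keeps \<open>s\<close> out: the initial
        Zero, a One at \<open>i\<close>, or a Zero right after \<open>i\<close>. Freeing it can
        bring in no vertex other than \<open>s\<close>.\<close>
      have "\<exists>k. r k \<noteq> Star \<and> support (r(k := Star)) \<subseteq> insert s (support r)"
      proof (cases s)
        case None
        then have 0: "r (Min UNIV) = Zero" using s by simp
        have "t \<in> insert s (support r)" if "t \<in> support (r(Min UNIV := Star))" for t
          using that 0 None by (cases t) (auto split: if_splits)
        with 0 show ?thesis by (intro exI[of _ "Min UNIV"]) auto
      next
        case (Some i)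
        show ?thesis
        proof (cases "r i = One")
          case True
          have "t \<in> insert s (support r)" if "t \<in> support (r(i := Star))" for t
            using that True Some by (cases t) (auto split: if_splits)
          with True show ?thesis by (intro exI[of _ i]) auto
        next
          case False
          then obtain j where j: "consecutive i j" "r j = Zero" using s Some by auto
          then have "i < j" by (simp add: consecutive_less)
          then have min: "j \<noteq> Min UNIV" using Min_UNIV_le[of i] by auto
          have "t \<in> insert s (support r)" if "t \<in> support (r(j := Star))" for t
            using that j Some min
            by (cases t) (auto split: if_splits dest: consecutive_left_unique)
          with j show ?thesis by (intro exI[of _ j]) auto
        qed
      qed
      then show ?thesis using IH s less.prems by (meson insert_subset order_trans)
    qed
  qed
qed

text \<open>Because of the strict bound \<open>j<k\<close>, the least vertex of \<open>S\<close>, if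
  it is an index, is itself a Zero and gets no Star; \<open>None\<close> counts as preceding all
  indices. The stars stand as far right as sliding can push them.\<close>

definition normal_form :: "'n::{finite,linorder} option set \<Rightarrow> 'n \<Rightarrow> symbol" where
  "normal_form S k =
     (if None \<notin> S \<and> (\<forall>j<k. Some j \<notin> S) then Zero else if Some k \<in> S then Star else One)"

lemma normal_form_Zero_iff: "normal_form S k = Zero \<longleftrightarrow> None \<notin> S \<and> (\<forall>j<k. Some j \<notin> S)"
  and normal_form_One_iff:
    "normal_form S k = One \<longleftrightarrow> Some k \<notin> S \<and> (None \<in> S \<or> (\<exists>j<k. Some j \<in> S))"
  and normal_form_Star_iff:
    "normal_form S k = Star \<longleftrightarrow> Some k \<in> S \<and> (None \<in> S \<or> (\<exists>j<k. Some j \<in> S))"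
  by (auto simp: normal_form_def)

lemma reduced_normal_form: "reduced_paradiagram (normal_form S)"
  unfolding reduced_paradiagram_def normal_form_One_iff normal_form_Zero_iff
  by (meson consecutive_less less_trans)

lemma support_normal_form:
  fixes S :: "'n::{finite,linorder} option set"
  assumes "S \<noteq> {}"
  shows "support (normal_form S) = S"
proof -
  have "s \<in> support (normal_form S) \<longleftrightarrow> s \<in> S" for s
  proof (cases s)
    case None
    have "normal_form S (Min UNIV) = Zero \<longleftrightarrow> None \<notin> S"
      unfolding normal_form_Zero_iff using leD[OF Min_UNIV_le] by blast
    then show ?thesis using None by simp
  next
    case (Some k)
    show ?thesis
    proof (cases "Some k \<in> S")
      case True
      then show ?thesis
        using Some consecutive_less
        by (auto simp: normal_form_Zero_iff normal_form_One_iff)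
    next
      case False
      show ?thesis
      proof (cases "normal_form S k = One")
        case True
        then show ?thesis using Some False by simp
      next
        case nonone: False
        then have n: "None \<notin> S" "\<forall>j<k. Some j \<notin> S"
          using False by (auto simp: normal_form_One_iff)
        then have le: "\<forall>j\<le>k. Some j \<notin> S" using False by (auto simp: le_less)
        \<comment> \<open>A vertex of \<open>S\<close> beyond \<open>k\<close> guarantees that
          \<open>k\<close> has a successor, and that successor still belongs to the initial run of
          zeros.\<close>
        from assms n(1) obtain j where "Some j \<in> S" by (metis all_not_in_conv option.exhaust)
        then have "k < j" using le not_le by blast
        then obtain l where l: "consecutive k l" by (rule obtain_next)
        then have "normal_form S l = Zero" using n(1) le
          by (auto simp: normal_form_Zero_iff consecutive_def not_less)
        then show ?thesis using Some False l by auto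
      qed
    qed
  qed
  then show ?thesis by blast
qed

text \<open>Exactly the least vertex of \<open>S\<close> carries no Star. A class therefore gets the
  dimension of the simplex face spanned by \<open>S\<close>.\<close>

lemma card_Star_normal_form:
  fixes S :: "'n::{finite,linorder} option set"
  assumes "S \<noteq> {}"
  shows "Suc (card {k. normal_form S k = Star}) = card S"
proof (cases "None \<in> S")
  case True
  then have "S = insert None (Some ` {k. normal_form S k = Star})"
    by (auto simp: normal_form_Star_iff image_iff) (metis option.exhaust)
  moreover have "card (insert None (Some ` {k. normal_form S k = Star})) = Suc (card {k. normal_form S k = Star})"
    by (subst card_insert_disjoint) (auto simp: card_image)
  ultimately show ?thesis by metis
next
  case False
  define T where "T = {k. Some k \<in> S}"
  have S: "S = Some ` T"
    using False by (auto simp: T_def image_iff) (metis option.exhaust)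
  then have "T \<noteq> {}" using assms by auto
  have "{k. normal_form S k = Star} = T - {Min T}"
  proof -
    have "k \<in> T \<and> (\<exists>j<k. j \<in> T) \<longleftrightarrow> k \<in> T - {Min T}" for k
      using \<open>T \<noteq> {}\<close> Min_in[of T] Min_le[of T k] Min_le[of T]
      by (metis Diff_iff finite insertE insertI1 linorder_not_less order_le_less singletonD)
    then show ?thesis using False by (auto simp: normal_form_Star_iff T_def)
  qed
  moreover have "Min T \<in> T" using \<open>T \<noteq> {}\<close> by simp
  ultimately have "Suc (card {k. normal_form S k = Star}) = card T"
    using card_Suc_Diff1[of T "Min T"] by (simp only: finite)
  also have "\<dots> = card S" by (simp add: S card_image)
  finally show ?thesis .
qed

text \<open>The L-move from \<open>*0\<close> to \<open>1*\<close>, oriented and encoded by the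
  paradiagram \<open>r\<close> of the common non-reduced facet, which has \<open>10\<close> in these
  places; the two faces free one of the two entries each.\<close>

inductive slide :: "('n::{finite,linorder} \<Rightarrow> symbol) \<Rightarrow> ('n \<Rightarrow> symbol) \<Rightarrow> bool" where
  "consecutive a b \<Longrightarrow> r a = One \<Longrightarrow> r b = Zero \<Longrightarrow>
   reduced_paradiagram (r(a := Star)) \<Longrightarrow> reduced_paradiagram (r(b := Star)) \<Longrightarrow>
   slide (r(a := Star)) (r(b := Star))"

lemma slide_support: "slide p q \<Longrightarrow> support p = support q"
  by (induction rule: slide.induct) (metis support_fun_upd_Star)

text \<open>The zeros form an initial run, whose length can be read off from the support. Beyond it
  no entry is followed by Zero, so the support decides between Star and One.\<close>

lemma eq_normal_form:
  fixes p :: "'n::{finite,linorder} \<Rightarrow> symbol"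
  assumes nz: "\<And>i j. consecutive i j \<Longrightarrow> p j = Zero \<Longrightarrow> p i = Zero"
  shows "p = normal_form (support p)"
proof
  fix k
  have down: "p i = Zero" if "p k = Zero" "i \<le> k" for i k
  proof (rule ccontr)
    assume "p i \<noteq> Zero"
    with \<open>i \<le> k\<close> have "p k \<noteq> Zero"
      by (induction rule: consecutive_induct) (use nz in blast)+
    then show False using that by simp
  qed
  have zero: "p k = Zero \<longleftrightarrow> normal_form (support p) k = Zero" for k
  proof
    assume z: "p k = Zero"
    have "p (Min UNIV) = Zero" by (rule down[OF z Min_UNIV_le])
    moreover have "Some j \<notin> support p" if "j < k" for j
    proof -
      obtain l where "consecutive j l" "l \<le> k" using \<open>j < k\<close> by (rule obtain_next)
      then show ?thesis unfolding Some_in_support using down[OF z] by blast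
    qed
    ultimately show "normal_form (support p) k = Zero" by (simp add: normal_form_Zero_iff)
  next
    assume "normal_form (support p) k = Zero"
    then have n: "p (Min UNIV) = Zero" "\<forall>j<k. Some j \<notin> support p"
      by (auto simp: normal_form_Zero_iff)
    show "p k = Zero"
    proof (rule zero_prefix)
      fix i j assume ij: "consecutive i j" "j \<le> k" "p i = Zero"
      have "Some i \<notin> support p"
        by (rule n(2)[rule_format, OF less_le_trans[OF consecutive_less[OF ij(1)] ij(2)]])
      then obtain l where "consecutive i l" "p l = Zero"
        unfolding Some_in_support using ij(3) by auto
      then show "p j = Zero" using consecutive_right_unique[OF ij(1)] by blast
    qed (fact n)
  qed
  show "p k = normal_form (support p) k"
  proof (cases "p k")
    case Zero
    then show ?thesis using zero by simp
  next
    case One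
    then have "Some k \<notin> support p" by simp
    then have "normal_form (support p) k \<noteq> Star" unfolding normal_form_Star_iff by blast
    moreover have "normal_form (support p) k \<noteq> Zero" using One zero[of k] by simp
    ultimately show ?thesis using One by (cases "normal_form (support p) k") auto
  next
    case Star
    then have "\<forall>j. consecutive k j \<longrightarrow> p j \<noteq> Zero" using nz by (metis symbol.distinct(3))
    with Star have "Some k \<in> support p" by simp
    then have "normal_form (support p) k \<noteq> One" unfolding normal_form_One_iff by blast
    moreover have "normal_form (support p) k \<noteq> Zero" using Star zero[of k] by simp
    ultimately show ?thesis using Star by (cases "normal_form (support p) k") auto
  qed
qed

text \<open>A Zero preceded by a nonzero entry is preceded by Star, by reducedness, so a slide
  applies. It creates a One and destroys none, which makes the process stop; then all zeros stand at
  the beginning.\<close>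

lemma slides_to_normal_form:
  fixes p :: "'n::{finite,linorder} \<Rightarrow> symbol"
  assumes "reduced_paradiagram p"
  shows "slide\<^sup>*\<^sup>* p (normal_form (support p))"
  using assms
proof (induction "card {k. p k \<noteq> One}" arbitrary: p rule: less_induct)
  case less
  show ?case
  proof (cases "\<exists>a b. consecutive a b \<and> p b = Zero \<and> p a \<noteq> Zero")
    case False
    then have "p = normal_form (support p)" using eq_normal_form by blast
    then show ?thesis by (metis rtranclp.rtrancl_refl)
  next
    case True
    then obtain a b where ab: "consecutive a b" "p b = Zero" "p a \<noteq> Zero" by blast
    with less.prems have pa: "p a = Star"
      by (metis reduced_paradiagram_def symbol.exhaust)
    have "a \<noteq> b" using consecutive_less[OF ab(1)] by simp
    define r where "r = p(a := One)"
    define q where "q = r(b := Star)"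
    have p: "p = r(a := Star)" using pa by (auto simp: r_def)
    have r: "r a = One" "r b = Zero" using ab \<open>a \<noteq> b\<close> by (auto simp: r_def)
    \<comment> \<open>The new One at \<open>a\<close> is followed by the Star at \<open>b\<close>,
      so no string \<open>10\<close> arises.\<close>
    have red: "reduced_paradiagram q"
      using less.prems ab(1) \<open>a \<noteq> b\<close>
      unfolding reduced_paradiagram_def q_def r_def
      by (metis consecutive_right_unique fun_upd_def symbol.distinct(1,3,5))
    have "slide (r(a := Star)) (r(b := Star))"
      by (rule slide.intros) (fact ab r red[unfolded q_def] less.prems[unfolded p])+
    then have "slide p q" by (simp only: p q_def)
    have "{k. q k \<noteq> One} \<subset> {k. p k \<noteq> One}"
    proof (rule psubsetI)
      have "p k \<noteq> One" if "q k \<noteq> One" for k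
        using that ab(2) by (cases "k = a"; cases "k = b") (simp_all add: q_def r_def)
      then show "{k. q k \<noteq> One} \<subseteq> {k. p k \<noteq> One}" by blast
      have "q a = One" "p a \<noteq> One" using pa \<open>a \<noteq> b\<close> by (simp_all add: q_def r_def)
      then show "{k. q k \<noteq> One} \<noteq> {k. p k \<noteq> One}" by blast
    qed
    then have "card {k. q k \<noteq> One} < card {k. p k \<noteq> One}" by (intro psubset_card_mono) auto
    from less.hyps[OF this red] slide_support[OF \<open>slide p q\<close>]
    have "slide\<^sup>*\<^sup>* q (normal_form (support p))" by simp
    with \<open>slide p q\<close> show ?thesis by (rule converse_rtranclp_into_rtranclp)
  qed
qed

section \<open>Faces and L-classes\<close>

locale coordinate_parallelepiped =
  fixes \<mu> \<nu> :: "(int, 'n::{finite,linorder}) vec"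
  assumes less: "\<mu> $ k < \<nu> $ k"
begin

definition lower_corner :: "('n \<Rightarrow> symbol) \<Rightarrow> (real, 'n) vec" where
  "lower_corner p = (\<chi> k. if p k = One then of_int (\<nu> $ k) else of_int (\<mu> $ k))"

definition upper_corner :: "('n \<Rightarrow> symbol) \<Rightarrow> (real, 'n) vec" where
  "upper_corner p = (\<chi> k. if p k = Zero then of_int (\<mu> $ k) else of_int (\<nu> $ k))"

definition face :: "('n \<Rightarrow> symbol) \<Rightarrow> (real, 'n) vec set" where
  "face p = cbox (lower_corner p) (upper_corner p)"

lemma corner_nth [simp]:
  "lower_corner p $ k = (if p k = One then of_int (\<nu> $ k) else of_int (\<mu> $ k))"
  "upper_corner p $ k = (if p k = Zero then of_int (\<mu> $ k) else of_int (\<nu> $ k))"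
  by (simp_all add: lower_corner_def upper_corner_def)

lemma int_less [simp]: "\<mu> $ k < \<nu> $ k" "\<mu> $ k \<le> \<nu> $ k" "\<mu> $ k \<noteq> \<nu> $ k" "\<nu> $ k \<noteq> \<mu> $ k"
  using less[of k] by linarith+

lemma real_less [simp]: "(of_int (\<mu> $ k) :: real) < of_int (\<nu> $ k)"
  and real_neq [simp]: "(of_int (\<mu> $ k) :: real) \<noteq> of_int (\<nu> $ k)"
    "(of_int (\<nu> $ k) :: real) \<noteq> of_int (\<mu> $ k)"
  by simp_all

lemma mem_parallelepiped:
  "y \<in> parallelepiped \<mu> \<nu> \<longleftrightarrow> (\<forall>k. of_int (\<mu> $ k) \<le> y $ k \<and> y $ k \<le> of_int (\<nu> $ k))"
  by (simp add: parallelepiped_def)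

lemma mem_face:
  "y \<in> face p \<longleftrightarrow> y \<in> parallelepiped \<mu> \<nu> \<and>
     (\<forall>k. (p k = Zero \<longrightarrow> y $ k = of_int (\<mu> $ k)) \<and> (p k = One \<longrightarrow> y $ k = of_int (\<nu> $ k)))"
proof -
  have "lower_corner p $ k \<le> y $ k \<and> y $ k \<le> upper_corner p $ k \<longleftrightarrow>
    (of_int (\<mu> $ k) \<le> y $ k \<and> y $ k \<le> of_int (\<nu> $ k)) \<and>
    (p k = Zero \<longrightarrow> y $ k = of_int (\<mu> $ k)) \<and> (p k = One \<longrightarrow> y $ k = of_int (\<nu> $ k))" for k
    using real_less[of k]
    by (cases "p k") (auto simp del: real_less int_less of_int_less_iff of_int_le_iff)
  then show ?thesis unfolding face_def mem_box_cart mem_parallelepiped by blast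
qed

lemma paradiagram_eq_iff:
  "paradiagram \<mu> \<nu> y k = Zero \<longleftrightarrow> y $ k = of_int (\<mu> $ k)"
  "paradiagram \<mu> \<nu> y k = One \<longleftrightarrow> y $ k = of_int (\<nu> $ k)"
  "paradiagram \<mu> \<nu> y k = Star \<longleftrightarrow> y $ k \<noteq> of_int (\<mu> $ k) \<and> y $ k \<noteq> of_int (\<nu> $ k)"
  by (auto simp: paradiagram_def)

lemma mem_face_refines:
  "y \<in> face p \<longleftrightarrow> y \<in> parallelepiped \<mu> \<nu> \<and> refines (paradiagram \<mu> \<nu> y) p"
proof -
  have "(p k \<noteq> Star \<longrightarrow> paradiagram \<mu> \<nu> y k = p k) \<longleftrightarrow>
    (p k = Zero \<longrightarrow> y $ k = of_int (\<mu> $ k)) \<and> (p k = One \<longrightarrow> y $ k = of_int (\<nu> $ k))" for k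
    by (cases "p k") (auto simp: paradiagram_eq_iff)
  then show ?thesis by (simp add: mem_face refines_def)
qed

lemma lower_corner_le: "lower_corner p $ k \<le> upper_corner p $ k"
  using real_less[of k] by (simp add: less_imp_le)

lemma lower_corner_less_iff: "lower_corner p $ k < upper_corner p $ k \<longleftrightarrow> p k = Star"
  by (cases "p k") auto

lemma aff_dim_face: "aff_dim (face p) = int (card {k. p k = Star})"
  unfolding face_def aff_dim_cbox_cart[OF lower_corner_le] lower_corner_less_iff ..

lemma mem_rel_interior_face:
  "y \<in> rel_interior (face p) \<longleftrightarrow> y \<in> parallelepiped \<mu> \<nu> \<and> paradiagram \<mu> \<nu> y = p"
proof -
  have "y \<in> rel_interior (face p) \<longleftrightarrow> y \<in> face p \<and>
    (\<forall>k. p k = Star \<longrightarrow> of_int (\<mu> $ k) < y $ k \<and> y $ k < of_int (\<nu> $ k))"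
    (is "_ \<longleftrightarrow> _ \<and> (\<forall>k. ?r k)")
    unfolding face_def rel_interior_cbox_cart[OF lower_corner_le] lower_corner_less_iff by auto
  also have "\<dots> \<longleftrightarrow> y \<in> parallelepiped \<mu> \<nu> \<and> paradiagram \<mu> \<nu> y = p"
  proof -
    have "(p k = Zero \<longrightarrow> y $ k = of_int (\<mu> $ k)) \<and> (p k = One \<longrightarrow> y $ k = of_int (\<nu> $ k)) \<and> ?r k
      \<longleftrightarrow> paradiagram \<mu> \<nu> y k = p k" if "y \<in> parallelepiped \<mu> \<nu>" for k
      using that[unfolded mem_parallelepiped, rule_format, of k]
      by (cases "p k") (auto simp: paradiagram_eq_iff)
    then show ?thesis unfolding mem_face fun_eq_iff by blast
  qed
  finally show ?thesis .
qed

lemma ex_paradiagram: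
  obtains y where "y \<in> parallelepiped \<mu> \<nu>" "paradiagram \<mu> \<nu> y = p"
proof
  let ?y = "(\<chi> k. case p k of Zero \<Rightarrow> of_int (\<mu> $ k) | One \<Rightarrow> of_int (\<nu> $ k)
    | Star \<Rightarrow> (of_int (\<mu> $ k) + of_int (\<nu> $ k)) / 2) :: (real, 'n) vec"
  have "of_int (\<mu> $ k) \<le> ?y $ k \<and> ?y $ k \<le> of_int (\<nu> $ k) \<and> paradiagram \<mu> \<nu> ?y k = p k" for k
    using real_less[of k] by (cases "p k") (simp_all add: paradiagram_def)
  then show "?y \<in> parallelepiped \<mu> \<nu>" "paradiagram \<mu> \<nu> ?y = p"
    by (auto simp: mem_parallelepiped)
qed

lemma face_nonempty: "face p \<noteq> {}"
  by (metis ex_paradiagram mem_rel_interior_face empty_iff rel_interior_empty)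

lemma parallelepiped_eq_face: "parallelepiped \<mu> \<nu> = face (\<lambda>_. Star)"
  by (auto simp: mem_face)

lemma face_of_parallelepiped: "face p face_of parallelepiped \<mu> \<nu>"
  unfolding parallelepiped_eq_face unfolding face_def
  by (rule cbox_cart_face_of) (use real_less in \<open>auto intro: less_imp_le\<close>)

lemma face_paradiagram_face [simp]: "face_paradiagram \<mu> \<nu> (face p) = p"
  unfolding face_paradiagram_def
proof (rule the_equality)
  fix q assume "\<forall>y\<in>rel_interior (face p). paradiagram \<mu> \<nu> y = q"
  then show "q = p" by (metis ex_paradiagram mem_rel_interior_face)
qed (simp add: mem_rel_interior_face)

lemma face_inject: "face p = face q \<longleftrightarrow> p = q"
  by (metis face_paradiagram_face)

lemma nonempty_faces_parallelepiped: "nonempty_faces (parallelepiped \<mu> \<nu>) = range face"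
proof (intro subset_antisym subsetI)
  fix F assume "F \<in> nonempty_faces (parallelepiped \<mu> \<nu>)"
  then have F: "F face_of parallelepiped \<mu> \<nu>" "F \<noteq> {}" by (auto simp: nonempty_faces_def)
  then obtain y where y: "y \<in> rel_interior F"
    using face_of_imp_convex[OF F(1)] rel_interior_eq_empty
    by (metis all_not_in_conv)
  then have "y \<in> parallelepiped \<mu> \<nu>"
    using F face_of_imp_subset rel_interior_subset by blast
  then have "y \<in> rel_interior (face (paradiagram \<mu> \<nu> y))" by (simp add: mem_rel_interior_face)
  \<comment> \<open>Faces whose relative interiors meet coincide.\<close>
  with y have "F = face (paradiagram \<mu> \<nu> y)"
    using face_of_eq[OF F(1) face_of_parallelepiped] by blast
  then show "F \<in> range face" by blast
qed (auto simp: nonempty_faces_def face_nonempty face_of_parallelepiped)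

lemma reduced_faces_eq: "reduced_faces \<mu> \<nu> = face ` {p. reduced_paradiagram p}"
  unfolding reduced_faces_def nonempty_faces_parallelepiped by auto

lemma face_subset_iff: "face p \<subseteq> face q \<longleftrightarrow> refines p q"
proof
  obtain y where "y \<in> parallelepiped \<mu> \<nu>" "paradiagram \<mu> \<nu> y = p" by (rule ex_paradiagram)
  moreover assume "face p \<subseteq> face q"
  ultimately show "refines p q"
    by (metis mem_face_refines refines_def subsetD)
qed (auto simp: mem_face_refines refines_def)

lemma face_Int_fun_upd:
  "a \<noteq> b \<Longrightarrow> face (r(a := Star)) \<inter> face (r(b := Star)) = face r"
  unfolding set_eq_iff Int_iff mem_face_refines refines_fun_upd_Star unfolding refines_def by metis

lemma face_of_face: "refines p q \<Longrightarrow> face p face_of face q"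
  using face_of_subset[OF face_of_parallelepiped] face_subset_iff
    face_of_imp_subset[OF face_of_parallelepiped] by blast

lemma card_Star_fun_upd:
  fixes r :: "'n \<Rightarrow> symbol"
  assumes "r a \<noteq> Star"
  shows "card {k. (r(a := Star)) k = Star} = Suc (card {k. r k = Star})"
proof -
  have "{k. (r(a := Star)) k = Star} = insert a {k. r k = Star}" by auto
  with assms show ?thesis by simp
qed

lemma facet_of_fun_upd: "r a \<noteq> Star \<Longrightarrow> face r facet_of face (r(a := Star))"
  unfolding facet_of_def aff_dim_face card_Star_fun_upd
  by (auto simp: face_nonempty refines_def intro!: face_of_face)

text \<open>The dimension counts stars, and passing to a larger face only frees entries, so exactly
  one entry is freed.\<close>

lemma facet_of_face_cases:
  assumes "face r facet_of face p"
  obtains a where "p = r(a := Star)" "r a \<noteq> Star"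
proof -
  have "face r \<subseteq> face p" using assms by (simp add: facet_of_imp_subset)
  then have ref: "refines r p" by (simp add: face_subset_iff)
  then have sub: "{k. r k = Star} \<subseteq> {k. p k = Star}"
    by (auto simp: refines_def)
  have "card {k. p k = Star} = Suc (card {k. r k = Star})"
    using assms by (simp add: facet_of_def aff_dim_face)
  with sub have "card ({k. p k = Star} - {k. r k = Star}) = 1"
    by (simp add: card_Diff_subset)
  then obtain a where "{k. p k = Star} - {k. r k = Star} = {a}" by (auto simp: card_1_singleton_iff)
  then have a: "p k = Star \<and> r k \<noteq> Star \<longleftrightarrow> k = a" for k by auto
  then have "p k = (r(a := Star)) k" for k using ref a[of k] by (auto simp: refines_def) metis
  then show ?thesis using a[of a] by (intro that[of a]) auto
qed

section \<open>L-moves and L-classes in terms of paradiagrams\<close>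

lemma L_move_if_slide:
  assumes "slide p q"
  shows "L_move \<mu> \<nu> (face p) (face q)"
  using assms
proof cases
  case (1 a b r)
  then have ab: "a \<noteq> b" using consecutive_less by blast
  have "\<not> reduced_paradiagram r" using 1 by (auto simp: reduced_paradiagram_def)
  then show ?thesis
    unfolding 1(1,2) L_move_def face_Int_fun_upd[OF ab]
    using 1 by (auto simp: reduced_faces_eq facet_of_fun_upd aff_dim_face card_Star_fun_upd simp del: fun_upd_apply)
qed

text \<open>The common facet contains a string \<open>10\<close>. Each of the two reduced faces
  frees a single entry of it, which must lie in that string, and they free different ones.\<close>

lemma slide_if_L_move:
  assumes "L_move \<mu> \<nu> (face p) (face q)"
  shows "slide p q \<or> slide q p"
proof -
  have red: "reduced_paradiagram p" "reduced_paradiagram q"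
    and fac: "(face p \<inter> face q) facet_of face p" "(face p \<inter> face q) facet_of face q"
    and nred: "\<not> reduced_paradiagram (face_paradiagram \<mu> \<nu> (face p \<inter> face q))"
    using assms by (auto simp: L_move_def reduced_faces_eq face_inject)
  have "face p \<inter> face q \<in> nonempty_faces (parallelepiped \<mu> \<nu>)"
    using fac(1) face_of_trans[OF _ face_of_parallelepiped]
    by (auto simp: nonempty_faces_def facet_of_def)
  then obtain r where r: "face p \<inter> face q = face r"
    unfolding nonempty_faces_parallelepiped by blast
  obtain a where a: "p = r(a := Star)" "r a \<noteq> Star"
    using facet_of_face_cases fac(1) r by metis
  obtain b where b: "q = r(b := Star)" "r b \<noteq> Star"
    using facet_of_face_cases fac(2) r by metis
  \<comment> \<open>Otherwise the two faces would coincide and their intersection would be no proper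
    face.\<close>
  have "a \<noteq> b"
  proof
    assume "a = b"
    then have "face p = face r" using a b r by simp
    then show False using a by (metis face_inject fun_upd_same)
  qed
  obtain c d where cd: "consecutive c d" "r c = One" "r d = Zero"
    using nred unfolding r by (auto simp: reduced_paradiagram_def)
  have "a = c \<or> a = d"
    using red(1) cd unfolding a(1) reduced_paradiagram_def by (metis fun_upd_other)
  moreover have "b = c \<or> b = d"
    using red(2) cd unfolding b(1) reduced_paradiagram_def by (metis fun_upd_other)
  ultimately have "a = c \<and> b = d \<or> a = d \<and> b = c" using \<open>a \<noteq> b\<close> by blast
  then show ?thesis using slide.intros[OF cd] red a(1) b(1) by metis
qed

text \<open>The candidate for the L-class of \<open>S\<close>. It is empty for empty
  \<open>S\<close>, which later accounts for disjoint faces of the simplex.\<close>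

definition cell :: "'n option set \<Rightarrow> (real, 'n) vec set set" where
  "cell S = face ` {p. reduced_paradiagram p \<and> support p = S}"

text \<open>Slides in either direction keep the support; conversely, equal supports lead to the same
  normal form.\<close>

lemma equivclp_L_move_face_iff:
  assumes "reduced_paradiagram p" "reduced_paradiagram q"
  shows "equivclp (L_move \<mu> \<nu>) (face p) (face q) \<longleftrightarrow> support p = support q"
proof
  \<comment> \<open>The invariant is phrased through \<open>face_paradiagram\<close> because the
    induction along a chain of moves runs over sets, not paradiagrams.\<close>
  have support: "support (face_paradiagram \<mu> \<nu> F) = support (face_paradiagram \<mu> \<nu> G)"
    if FG: "L_move \<mu> \<nu> F G" for F G
  proof -
    obtain p q where pq: "F = face p" "G = face q"
      using FG unfolding L_move_def reduced_faces_eq by blast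
    then have "slide p q \<or> slide q p" using FG slide_if_L_move by simp
    then have "support p = support q" using slide_support by metis
    then show ?thesis by (simp add: pq)
  qed
  assume "equivclp (L_move \<mu> \<nu>) (face p) (face q)"
  then have "support (face_paradiagram \<mu> \<nu> (face p)) = support (face_paradiagram \<mu> \<nu> (face q))"
    by (induction rule: equivclp_induct) (use support in auto)
  then show "support p = support q" by simp
next
  have normalize: "equivclp (L_move \<mu> \<nu>) (face p) (face (normal_form (support p)))"
    if "reduced_paradiagram p" for p
    using slides_to_normal_form[OF that]
  proof (induction rule: rtranclp_induct)
    case (step q r)
    then show ?case using L_move_if_slide[of q r] by (meson equivclp_into_equivclp)
  qed (simp add: equivclp_refl)
  assume "support p = support q"
  then show "equivclp (L_move \<mu> \<nu>) (face p) (face q)"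
    using normalize assms by (metis equivclp_sym equivclp_trans)
qed

lemma cell_eq_L_class:
  assumes "reduced_paradiagram p"
  shows "L_equivalence \<mu> \<nu> `` {face p} = cell (support p)"
  using assms by (auto simp: L_equivalence_def reduced_faces_eq cell_def equivclp_L_move_face_iff)

lemma L_classes_eq: "L_classes \<mu> \<nu> = cell ` {S. S \<noteq> {}}"
proof -
  have "L_classes \<mu> \<nu> = (\<lambda>p. cell (support p)) ` {p. reduced_paradiagram p}"
    by (auto simp: L_classes_def quotient_def reduced_faces_eq cell_eq_L_class)
  also have "\<dots> = cell ` {S. S \<noteq> {}}"
  proof -
    have "support ` {p. reduced_paradiagram p} = {S :: 'n option set. S \<noteq> {}}"
    proof (intro subset_antisym subsetI)
      fix S :: "'n option set" assume "S \<in> {S. S \<noteq> {}}"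
      then show "S \<in> support ` {p. reduced_paradiagram p}"
        by (intro image_eqI[of _ support "normal_form S"])
          (simp_all add: support_normal_form reduced_normal_form)
    next
      fix S assume "S \<in> support ` {p :: 'n \<Rightarrow> symbol. reduced_paradiagram p}"
      then obtain p :: "'n \<Rightarrow> symbol" where "S = support p" by (rule imageE)
      then show "S \<in> {S. S \<noteq> {}}" using support_nonempty[of p] by simp
    qed
    then show ?thesis by (simp only: image_image[of cell support, symmetric])
  qed
  finally show ?thesis .
qed

lemma inj_on_cell: "inj_on cell {S. S \<noteq> {}}"
proof (rule inj_onI)
  fix S T assume S: "S \<in> {S. S \<noteq> {}}" and "cell S = cell T"
  have "face (normal_form S) \<in> cell S"
    unfolding cell_def using S by (simp add: support_normal_form reduced_normal_form)
  then have "face (normal_form S) \<in> cell T" using \<open>cell S = cell T\<close> by simp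
  then have "support (normal_form S) = T" by (auto simp: cell_def face_inject)
  then show "S = T" using S by (simp add: support_normal_form)
qed

text \<open>One inclusion is monotonicity of the support, the other is coarsening the paradiagram of
  the point. The intersection property follows at once.\<close>

lemma Union_cell:
  "\<Union>(cell S) = {y \<in> parallelepiped \<mu> \<nu>. support (paradiagram \<mu> \<nu> y) \<subseteq> S}"
proof (intro subset_antisym subsetI)
  fix y assume "y \<in> \<Union>(cell S)"
  then show "y \<in> {y \<in> parallelepiped \<mu> \<nu>. support (paradiagram \<mu> \<nu> y) \<subseteq> S}"
    using support_mono by (fastforce simp: cell_def mem_face_refines)
next
  fix y assume "y \<in> {y \<in> parallelepiped \<mu> \<nu>. support (paradiagram \<mu> \<nu> y) \<subseteq> S}"
  then show "y \<in> \<Union>(cell S)"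
    using ex_reduced_coarsening[of "paradiagram \<mu> \<nu> y" S]
    by (auto simp: cell_def mem_face_refines)
qed

lemma Union_cell_Int: "\<Union>(cell S) \<inter> \<Union>(cell T) = \<Union>(cell (S \<inter> T))"
  unfolding Union_cell by auto

lemma Union_cell_empty: "\<Union>(cell {}) = {}"
  unfolding Union_cell using support_nonempty by auto

lemma compact_Union_cell: "compact (\<Union>(cell S))"
proof (rule compact_Union)
  have "cell S \<subseteq> {F. F face_of parallelepiped \<mu> \<nu>}"
    using face_of_parallelepiped by (auto simp: cell_def)
  moreover have "finite {F. F face_of parallelepiped \<mu> \<nu>}"
    unfolding parallelepiped_eq_face face_def by (intro finite_polytope_faces polytope_interval)
  ultimately show "finite (cell S)" by (rule finite_subset)
qed (auto simp: cell_def face_def)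

text \<open>L-moves preserve the dimension, so it can be computed at the normal form.\<close>

lemma aff_dim_cell:
  assumes "S \<noteq> {}" "F \<in> cell S"
  shows "aff_dim F = int (card {k. normal_form S k = Star})"
proof -
  obtain p where p: "F = face p" "reduced_paradiagram p" "support p = S"
    using assms by (auto simp: cell_def)
  have "slide\<^sup>*\<^sup>* p (normal_form S)" using slides_to_normal_form p by blast
  then have "aff_dim (face p) = aff_dim (face (normal_form S))"
  proof (induction rule: rtranclp_induct)
    case (step q r)
    then show ?case using L_move_if_slide[of q r] by (simp add: L_move_def)
  qed simp
  then show ?thesis by (simp add: p aff_dim_face)
qed

end

section \<open>The topology of an L-class\<close>

text \<open>An amount \<open>t\<close> is poured into containers of capacities \<open>l k\<close>,
  filled in increasing order. Adding a largest index does not affect what the earlier ones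
  receive.\<close>

lemma sum_clamp:
  fixes l :: "'a::linorder \<Rightarrow> real"
  assumes "finite A" "\<And>k. k \<in> A \<Longrightarrow> 0 \<le> l k" "0 \<le> t"
  shows "(\<Sum>k\<in>A. max 0 (min (l k) (t - sum l {i\<in>A. i < k}))) = min t (sum l A)"
  using assms(1,2)
proof (induction A rule: finite_linorder_max_induct)
  case empty
  then show ?case using \<open>0 \<le> t\<close> by simp
next
  case (insert b A)
  have b: "b \<notin> A" using insert.hyps(2) by blast
  have "{i \<in> insert b A. i < k} = {i \<in> A. i < k}" if "k \<in> A" for k
    using insert.hyps(2) that by auto
  then have "(\<Sum>k\<in>A. max 0 (min (l k) (t - sum l {i\<in>insert b A. i < k}))) = min t (sum l A)"
    using insert.IH insert.prems by simp
  moreover have "{i \<in> insert b A. i < b} = A" using insert.hyps(2) by auto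
  moreover have "0 \<le> l b" "0 \<le> sum l A" using insert.prems by (auto intro: sum_nonneg)
  ultimately show ?case using insert.hyps(1) b by simp
qed

text \<open>For \<open>d\<close> a Star of the normal form, these are the coordinates after the
  preceding vertex of \<open>S\<close>, up to and including \<open>d\<close>.\<close>

definition block :: "'n::{finite,linorder} option set \<Rightarrow> 'n \<Rightarrow> 'n set" where
  "block S d = {k. k \<le> d \<and> (\<forall>j. k \<le> j \<and> j < d \<longrightarrow> Some j \<notin> S)}"

text \<open>The cases are the coordinates up to the least vertex of \<open>S\<close>, those after
  the last one, and those in between, where \<open>d\<close> is the first vertex of \<open>S\<close>
  at or after \<open>k\<close>.\<close>

lemma block_trichotomy:
  fixes k :: "'n::{finite,linorder}"
  obtains "normal_form S k = Zero" | "\<forall>j\<ge>k. Some j \<notin> S"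
  | d where "normal_form S d = Star" "k \<in> block S d"
proof (cases "normal_form S k = Zero \<or> (\<forall>j\<ge>k. Some j \<notin> S)")
  case False
  define A where "A = {j. k \<le> j \<and> Some j \<in> S}"
  define d where "d = Min A"
  have "A \<noteq> {}" using False by (auto simp: A_def)
  then have "d \<in> A" unfolding d_def by (intro Min_in) auto
  then have d: "k \<le> d" "Some d \<in> S" by (auto simp: A_def)
  have least: "d \<le> j" if "k \<le> j" "Some j \<in> S" for j
    unfolding d_def using that by (intro Min_le) (auto simp: A_def)
  then have "k \<in> block S d" using d by (auto simp: block_def not_le[symmetric])
  moreover have "normal_form S d = Star"
    using False d(2) less_le_trans[OF _ d(1)]
    by (auto simp: normal_form_Star_iff normal_form_Zero_iff)
  ultimately show ?thesis using that(3) by blast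
qed (use that in blast)

lemma block_unique:
  assumes "k \<in> block S d" "k \<in> block S e" "Some d \<in> S" "Some e \<in> S"
  shows "d = e"
  using assms unfolding block_def by (auto intro: linorder_neqE[of d e])

lemma block_next:
  assumes "consecutive i j" "i \<in> block S d" "i \<noteq> d"
  shows "j \<in> block S d"
proof -
  have "i < j" "j \<le> d"
    using assms by (auto simp: consecutive_def block_def not_less[symmetric] order_le_less)
  then show ?thesis using assms(2) by (auto simp: block_def)
qed

lemma normal_form_block:
  assumes "normal_form S d = Star" "k \<in> block S d"
  shows "normal_form S k \<noteq> Zero"
  using assms unfolding normal_form_Star_iff normal_form_Zero_iff block_def
  by (metis (mono_tags, lifting) linorder_not_le mem_Collect_eq)

section \<open>Coordinates on a cell\<close>

context coordinate_parallelepiped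
begin

lemma mem_Union_cell:
  "y \<in> \<Union>(cell S) \<longleftrightarrow> y \<in> parallelepiped \<mu> \<nu> \<and>
     (None \<notin> S \<longrightarrow> y $ Min UNIV = of_int (\<mu> $ Min UNIV)) \<and>
     (\<forall>i. Some i \<notin> S \<longrightarrow> y $ i = of_int (\<nu> $ i) \<or>
        (\<exists>j. consecutive i j \<and> y $ j = of_int (\<mu> $ j)))"
proof -
  let ?p = "paradiagram \<mu> \<nu> y"
  have "support ?p \<subseteq> S \<longleftrightarrow>
    (None \<notin> S \<longrightarrow> None \<notin> support ?p) \<and> (\<forall>i. Some i \<notin> S \<longrightarrow> Some i \<notin> support ?p)"
    unfolding subset_eq by (metis option.exhaust)
  then show ?thesis unfolding Union_cell by (simp add: paradiagram_eq_iff)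
qed

context
  fixes S :: "'n option set" and y :: "(real, 'n) vec"
  assumes y: "y \<in> \<Union>(cell S)"
begin

lemma cell_bounds: "of_int (\<mu> $ k) \<le> y $ k" "y $ k \<le> of_int (\<nu> $ k)"
  using y unfolding mem_Union_cell mem_parallelepiped by blast+

lemma cell_step:
  assumes "Some i \<notin> S" "consecutive i j" "y $ i < of_int (\<nu> $ i)"
  shows "y $ j = of_int (\<mu> $ j)"
  using y assms unfolding mem_Union_cell by (metis consecutive_right_unique less_irrefl)

lemma cell_later:
  assumes "i < k" "\<And>j. i \<le> j \<Longrightarrow> j < k \<Longrightarrow> Some j \<notin> S" "y $ i < of_int (\<nu> $ i)"
  shows "y $ k = of_int (\<mu> $ k)"
proof -
  have "i \<le> k" using assms(1) by simp
  \<comment> \<open>The alternative \<open>k = i\<close> provides the start of the induction;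
    afterwards each coordinate is at its lower bound, hence below its upper bound, and forces the
    next one down.\<close>
  then have "k = i \<or> y $ k = of_int (\<mu> $ k)"
  proof (induction rule: consecutive_induct)
    case (step j l)
    have "y $ j < of_int (\<nu> $ j)" using step(4) assms(3) by auto
    moreover have "Some j \<notin> S"
      using assms(2) step(2) less_le_trans[OF consecutive_less[OF step(1)] step(3)] by blast
    ultimately show ?case using cell_step step(1) by blast
  qed simp
  then show ?thesis using assms(1) by auto
qed

lemma cell_zero:
  assumes "normal_form S k = Zero"
  shows "y $ k = of_int (\<mu> $ k)"
  using Min_UNIV_le[of k]
proof (induction rule: consecutive_induct)
  case base
  then show ?case using y assms unfolding mem_Union_cell normal_form_Zero_iff by blast
next
  case (step j l)
  have "Some j \<notin> S"
    using assms less_le_trans[OF consecutive_less[OF step(1)] step(3)]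
    unfolding normal_form_Zero_iff by blast
  then show ?case using cell_step[OF _ step(1)] step(4) by simp
qed

text \<open>A coordinate below its upper bound would force all later ones below theirs. At the last
  index this is impossible, as there is no successor to satisfy the other alternative.\<close>

lemma cell_one:
  assumes "\<forall>j\<ge>k. Some j \<notin> S"
  shows "y $ k = of_int (\<nu> $ k)"
proof (rule ccontr)
  assume "y $ k \<noteq> of_int (\<nu> $ k)"
  then have k: "y $ k < of_int (\<nu> $ k)" using cell_bounds(2)[of k] by simp
  define m where "m = Max (UNIV :: 'n set)"
  have max: "j \<le> m" for j unfolding m_def by (rule Max_ge) auto
  have "y $ m < of_int (\<nu> $ m)"
    using max[of k]
  proof (induction rule: consecutive_induct)
    case (step j l)
    then show ?case using cell_step[of j l] assms by simp
  qed (rule k)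
  moreover have "Some m \<notin> S" using assms max by blast
  ultimately obtain j where "consecutive m j"
    using y unfolding mem_Union_cell by (metis less_irrefl)
  then show False using max consecutive_less leD by blast
qed

end

text \<open>In each block this measures the length travelled along the edge path. The value 0
  elsewhere keeps the target in the same space, as a degenerate box.\<close>

definition block_sums :: "'n option set \<Rightarrow> (real, 'n) vec \<Rightarrow> (real, 'n) vec" where
  "block_sums S y = (\<chi> d. if normal_form S d = Star
     then \<Sum>k\<in>block S d. y $ k - of_int (\<mu> $ k) else 0)"

definition block_lengths :: "'n option set \<Rightarrow> (real, 'n) vec" where
  "block_lengths S = (\<chi> d. if normal_form S d = Star
     then \<Sum>k\<in>block S d. of_int (\<nu> $ k) - of_int (\<mu> $ k) else 0)"

lemma block_sums_nth:
  "normal_form S d = Star \<Longrightarrow> block_sums S y $ d = (\<Sum>k\<in>block S d. y $ k - of_int (\<mu> $ k))"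
  by (simp add: block_sums_def)

text \<open>On a block a point of a cell runs along a path of edges of a box, from the corner
  \<open>\<mu>\<close> to the corner \<open>\<nu>\<close> with all coordinates weakly increasing.\<close>

lemma inj_on_block_sums: "inj_on (block_sums S) (\<Union>(cell S))"
proof -
  have le: "y $ k \<le> z $ k"
    if y: "y \<in> \<Union>(cell S)" and z: "z \<in> \<Union>(cell S)" and eq: "block_sums S y = block_sums S z"
    for y z k
  proof (rule block_trichotomy[of S k])
    assume "normal_form S k = Zero"
    then show ?thesis using cell_zero y z by simp
  next
    assume "\<forall>j\<ge>k. Some j \<notin> S"
    then show ?thesis using cell_one y z by simp
  next
    fix d assume d: "normal_form S d = Star" "k \<in> block S d"
    show ?thesis
    proof (rule ccontr)
      assume "\<not> y $ k \<le> z $ k"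
      then have less: "z $ k < y $ k" by simp
      \<comment> \<open>As \<open>y\<close> has left its lower bound at \<open>k\<close>, it is at
        the top before \<open>k\<close>; as \<open>z\<close> has not reached the top at
        \<open>k\<close>, it is at the bottom after \<open>k\<close>. So \<open>y\<close> dominates
        \<open>z\<close> on the whole block, and the sums differ.\<close>
      have "z $ i \<le> y $ i" if i: "i \<in> block S d" for i
      proof -
        consider "i < k" | "i = k" | "k < i" by (rule linorder_cases)
        then show ?thesis
        proof cases
          case 1
          have "y $ i = of_int (\<nu> $ i)"
          proof (rule ccontr)
            assume "y $ i \<noteq> of_int (\<nu> $ i)"
            then have "y $ i < of_int (\<nu> $ i)" using cell_bounds(2)[OF y, of i] by simp
            then have "y $ k = of_int (\<mu> $ k)"
              using i d(2) by (intro cell_later[OF y 1]) (auto simp: block_def)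
            then show False using less cell_bounds(1)[OF z, of k] by simp
          qed
          then show ?thesis using cell_bounds(2)[OF z] by simp
        next
          case 3
          have "z $ k < of_int (\<nu> $ k)" using less cell_bounds(2)[OF y, of k] by simp
          then have "z $ i = of_int (\<mu> $ i)"
            using i d(2) by (intro cell_later[OF z 3]) (auto simp: block_def)
          then show ?thesis using cell_bounds(1)[OF y] by simp
        qed (use less in auto)
      qed
      then have "(\<Sum>i\<in>block S d. z $ i - of_int (\<mu> $ i)) < (\<Sum>i\<in>block S d. y $ i - of_int (\<mu> $ i))"
        using less d(2) by (intro sum_strict_mono_ex1) auto
      then show False using eq d(1) by (metis block_sums_nth less_irrefl)
    qed
  qed
  show ?thesis
  proof (rule inj_onI)
    fix y z assume "y \<in> \<Union>(cell S)" "z \<in> \<Union>(cell S)" "block_sums S y = block_sums S z"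
    then have "y $ k = z $ k" for k by (intro antisym; intro le) simp_all
    then show "y = z" by (simp add: vec_eq_iff)
  qed
qed

text \<open>A preimage of \<open>t\<close> is found by filling the coordinates of each block in
  increasing order until the total \<open>t $ d\<close> is used up.\<close>

lemma block_sums_image:
  assumes "S \<noteq> {}"
  shows "block_sums S ` \<Union>(cell S) = cbox 0 (block_lengths S)"
proof (intro subset_antisym subsetI)
  fix t assume "t \<in> block_sums S ` \<Union>(cell S)"
  then obtain y where y: "y \<in> \<Union>(cell S)" and t: "t = block_sums S y" by blast
  show "t \<in> cbox 0 (block_lengths S)"
    unfolding t mem_box_cart block_sums_def block_lengths_def
    using cell_bounds[OF y] by (auto intro!: sum_nonneg sum_mono)
next
  fix t :: "(real, 'n) vec" assume t: "t \<in> cbox 0 (block_lengths S)"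
  define l :: "'n \<Rightarrow> real" where "l k = of_int (\<nu> $ k) - of_int (\<mu> $ k)" for k
  \<comment> \<open>The height gained in coordinate \<open>k\<close> when the block of
    \<open>d\<close> is filled with total \<open>t $ d\<close>, clamped between 0 and the edge
    length.\<close>
  define c where "c d k = max 0 (min (l k) (t $ d - sum l {i \<in> block S d. i < k}))" for d k
  \<comment> \<open>The end of the block containing \<open>k\<close>, unique by
    \<open>block_unique\<close>.\<close>
  define top where "top k = (THE d. Some d \<in> S \<and> k \<in> block S d)" for k
  define y :: "(real, 'n) vec" where
    "y = (\<chi> k. if normal_form S k = Zero then of_int (\<mu> $ k)
      else if \<forall>j\<ge>k. Some j \<notin> S then of_int (\<nu> $ k)
      else of_int (\<mu> $ k) + c (top k) k)"
  have l: "0 \<le> l k" for k using real_less[of k] by (simp add: l_def less_imp_le)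
  have c: "0 \<le> c d k" "c d k \<le> l k" for d k using l[of k] by (auto simp: c_def)
  have y_block: "y $ k = of_int (\<mu> $ k) + c d k"
    if d: "normal_form S d = Star" "k \<in> block S d" for d k
  proof -
    have "Some d \<in> S" using d(1) by (simp add: normal_form_Star_iff)
    moreover from this have "top k = d"
      unfolding top_def using d(2) block_unique by blast
    moreover have "k \<le> d" using d(2) by (simp add: block_def)
    ultimately show ?thesis using normal_form_block[OF d] by (auto simp: y_def)
  qed
  have y_zero: "y $ k = of_int (\<mu> $ k)" if "normal_form S k = Zero" for k
    using that by (simp add: y_def)
  have y_bounds: "of_int (\<mu> $ k) \<le> y $ k \<and> y $ k \<le> of_int (\<nu> $ k)" for k
    using c[of "top k" k] real_less[of k] unfolding y_def l_def by (auto simp del: real_less)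
  have "y \<in> \<Union>(cell S)"
    unfolding mem_Union_cell
  proof (intro conjI impI allI)
    show "y \<in> parallelepiped \<mu> \<nu>" using y_bounds by (simp add: mem_parallelepiped)
    assume "None \<notin> S"
    then have "normal_form S (Min UNIV) = Zero"
      unfolding normal_form_Zero_iff using leD[OF Min_UNIV_le] by blast
    then show "y $ Min UNIV = of_int (\<mu> $ Min UNIV)" by (rule y_zero)
  next
    fix i assume i: "Some i \<notin> S"
    \<comment> \<open>The support of the normal form splits the condition for \<open>i\<close> into
      a One at \<open>i\<close> or a Zero right after it.\<close>
    then have "Some i \<notin> support (normal_form S)"
      using support_normal_form[OF assms] by metis
    then consider "normal_form S i = One" | j where "consecutive i j" "normal_form S j = Zero"
      by auto
    then show "y $ i = of_int (\<nu> $ i) \<or> (\<exists>j. consecutive i j \<and> y $ j = of_int (\<mu> $ j))"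
    proof cases
      case 2
      then show ?thesis using y_zero by blast
    next
      case 1
      show ?thesis
      proof (rule block_trichotomy[of S i])
        assume "\<forall>j\<ge>i. Some j \<notin> S"
        then show ?thesis using 1 by (simp add: y_def)
      next
        fix d assume d: "normal_form S d = Star" "i \<in> block S d"
        have "i < d" using d(2) i d(1) by (auto simp: block_def normal_form_Star_iff order_le_less)
        then obtain j where j: "consecutive i j" by (rule obtain_next)
        have jd: "j \<in> block S d" using block_next[OF j d(2)] \<open>i < d\<close> by simp
        have "{k \<in> block S d. k < j} = insert i {k \<in> block S d. k < i}"
          using j d(2) by (auto simp: consecutive_def not_less) (metis leD order_le_less)
        then have *: "sum l {k \<in> block S d. k < j} = l i + sum l {k \<in> block S d. k < i}"
          by simp
        show ?thesis
        proof (cases "c d i = l i")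
          case True
          then show ?thesis using y_block[OF d] by (simp add: l_def)
        next
          case False
          \<comment> \<open>If coordinate \<open>i\<close> is not filled completely, the total is
            exhausted before its successor \<open>j\<close>, which stays at its lower bound.\<close>
          then have "t $ d - sum l {k \<in> block S d. k < i} < l i"
            using l[of i] by (auto simp: c_def)
          then have "c d j = 0" using l[of j] by (simp add: c_def *)
          then show ?thesis using y_block[OF d(1) jd] j by auto
        qed
      qed (use 1 in simp)
    qed
  qed
  moreover have "block_sums S y = t"
  proof (rule vec_eq_iff[THEN iffD2], rule allI)
    fix d
    have td: "0 \<le> t $ d" "t $ d \<le> block_lengths S $ d" using t by (auto simp: mem_box_cart)
    show "block_sums S y $ d = t $ d"
    proof (cases "normal_form S d = Star")
      case True
      then have "block_sums S y $ d = (\<Sum>k\<in>block S d. c d k)"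
        unfolding block_sums_nth[OF True] using y_block by (intro sum.cong) auto
      also have "\<dots> = min (t $ d) (sum l (block S d))"
        unfolding c_def by (rule sum_clamp) (use l td in auto)
      also have "\<dots> = t $ d" using td(2) True by (simp add: block_lengths_def l_def)
      finally show ?thesis .
    next
      case False
      then show ?thesis using td by (simp add: block_sums_def block_lengths_def)
    qed
  qed
  ultimately show "t \<in> block_sums S ` \<Union>(cell S)" by blast
qed

lemma aff_dim_block_lengths:
  "aff_dim (cbox 0 (block_lengths S)) = int (card {k. normal_form S k = Star})"
proof -
  have pos: "0 < block_lengths S $ d \<longleftrightarrow> normal_form S d = Star"
    and nonneg: "0 \<le> block_lengths S $ d" for d
  proof -
    \<comment> \<open>A block contains its own end, and all edges have positive length, so the total
      length is positive.\<close>
    have "d \<in> block S d" by (auto simp: block_def)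
    then have "0 < (\<Sum>k\<in>block S d. of_int (\<nu> $ k) - of_int (\<mu> $ k) :: real)"
      by (intro sum_pos) auto
    then show "0 < block_lengths S $ d \<longleftrightarrow> normal_form S d = Star" "0 \<le> block_lengths S $ d"
      by (auto simp: block_lengths_def)
  qed
  have "aff_dim (cbox 0 (block_lengths S)) = int (card {k. (0 :: (real, 'n) vec) $ k < block_lengths S $ k})"
    by (rule aff_dim_cbox_cart) (simp add: nonneg)
  then show ?thesis by (simp add: pos)
qed

text \<open>The block sums map the compact cell bijectively and continuously onto a box, and compact
  convex sets of equal dimension are homeomorphic. A general \<open>A\<close> covers both the disk
  and the simplex face.\<close>

lemma Union_cell_homeomorphic:
  fixes A :: "'a::euclidean_space set"
  assumes "S \<noteq> {}" "convex A" "compact A" "aff_dim A = int (card S) - 1"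
  shows "\<Union>(cell S) homeomorphic A"
proof -
  have "continuous_on (\<Union>(cell S)) (block_sums S)"
    unfolding block_sums_def
  proof (intro continuous_on_vec_lambda)
    fix d show "continuous_on (\<Union>(cell S)) (\<lambda>y. if normal_form S d = Star
        then \<Sum>k\<in>block S d. y $ k - of_int (\<mu> $ k) else 0)"
      by (cases "normal_form S d = Star") (simp_all add: continuous_on_sum continuous_on_diff continuous_on_component)
  qed
  then have "\<Union>(cell S) homeomorphic cbox 0 (block_lengths S)"
    using compact_Union_cell inj_on_block_sums block_sums_image[OF assms(1)]
    by (intro homeomorphic_compact)
  also have "\<dots> homeomorphic A"
    using assms card_Star_normal_form[OF assms(1)]
    by (intro homeomorphic_convex_compact_sets) (auto simp: aff_dim_block_lengths)
  finally show ?thesis .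
qed

end

section \<open>The standard simplex and the correspondence\<close>

lemma affine_independent_axes: "\<not> affine_dependent ((\<lambda>i. axis i 1 :: real ^ 'k) ` K)"
proof -
  have "(\<lambda>i. axis i 1 :: real ^ 'k) ` K \<subseteq> Basis" by auto
  then have "independent ((\<lambda>i. axis i 1 :: real ^ 'k) ` K)"
    using independent_Basis independent_mono by blast
  then show ?thesis using affine_dependent_imp_dependent by blast
qed

lemma inj_axis_1: "inj (\<lambda>i. axis i 1 :: real ^ 'k)"
  by (auto simp: inj_on_def axis_eq_axis)

definition simplex_face :: "'k set \<Rightarrow> (real ^ 'k) set" where
  "simplex_face K = convex hull ((\<lambda>i. axis i 1) ` K)"

text \<open>The inverse of \<open>simplex_face\<close>, recovering the vertex set as the extreme
  points.\<close>

definition simplex_vertices :: "(real ^ 'k) set \<Rightarrow> 'k set" where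
  "simplex_vertices T = {i. axis i 1 extreme_point_of T}"

lemma simplex_vertices_simplex_face [simp]: "simplex_vertices (simplex_face K) = K"
  unfolding simplex_vertices_def simplex_face_def
    extreme_point_of_convex_hull_affine_independent[OF affine_independent_axes]
  by (auto simp: axis_eq_axis)

lemma simplex_face_eq_empty_iff [simp]: "simplex_face K = {} \<longleftrightarrow> K = {}"
  by (simp add: simplex_face_def)

text \<open>This holds because the vertices of both faces together are affinely independent.\<close>

lemma simplex_face_Int: "simplex_face K \<inter> simplex_face L = simplex_face (K \<inter> L)"
  unfolding simplex_face_def image_Int[OF inj_axis_1]
  by (rule convex_hull_Int[symmetric]) (simp only: image_Un[symmetric] affine_independent_axes not_False_eq_True)

lemma aff_dim_simplex_face: "aff_dim (simplex_face K) = int (card K) - 1"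
  using aff_dim_affine_independent[OF affine_independent_axes, of K]
  by (simp add: simplex_face_def aff_dim_convex_hull card_image inj_on_subset[OF inj_axis_1])

lemma nonempty_faces_standard_simplex:
  "nonempty_faces standard_simplex = simplex_face ` {K :: 'k::finite set. K \<noteq> {}}"
proof -
  have "F face_of standard_simplex \<longleftrightarrow> (\<exists>K. F = simplex_face K)" for F :: "(real ^ 'k) set"
    unfolding standard_simplex_def face_of_convex_hull_affine_independent[OF affine_independent_axes]
    by (auto simp: simplex_face_def subset_image_iff)
  then show ?thesis
    unfolding nonempty_faces_def using simplex_face_eq_empty_iff by blast
qed

lemma homeomorphic_to_diskI:
  fixes A :: "'a::euclidean_space set"
  assumes "d \<le> DIM('a)"
    and "\<And>B :: 'a set. convex B \<Longrightarrow> compact B \<Longrightarrow> aff_dim B = int d \<Longrightarrow> A homeomorphic B"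
  shows "homeomorphic_to_disk d A"
proof -
  obtain V :: "'a set" where V: "subspace V" "dim V = d"
    using choose_subspace_of_subspace[of d "UNIV :: 'a set"] assms(1) by (auto simp: dim_UNIV)
  \<comment> \<open>A convex set meeting the interior of the ball keeps its dimension when cut with
    the ball.\<close>
  have "0 \<in> V \<inter> interior (cball 0 1)" using V(1) by (simp add: subspace_0)
  then have "aff_dim (V \<inter> cball 0 1) = int d"
    using V by (subst aff_dim_convex_Int_nonempty_interior) (auto simp: subspace_imp_convex aff_dim_subspace)
  then have "A homeomorphic (cball 0 1 \<inter> V)"
    using V(1) by (intro assms(2))
      (auto simp: Int_commute convex_Int subspace_imp_convex compact_Int_closed closed_subspace)
  then show ?thesis using V unfolding homeomorphic_to_disk_def by blast
qed

theorem proposition6p6: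
  fixes \<mu> \<nu> :: "int ^ ('n::{finite,linorder})"
  assumes "\<And>k. \<mu> $ k < \<nu> $ k"
  shows "(\<forall>C \<in> L_classes \<mu> \<nu>.
            \<exists>d. (\<forall>F \<in> C. aff_dim F = int d) \<and> homeomorphic_to_disk d (\<Union>C)) \<and>
         (\<exists>\<Phi>. bij_betw \<Phi> (nonempty_faces (standard_simplex :: (real ^ 'n option) set))
                         (L_classes \<mu> \<nu>) \<and>
              (\<forall>S \<in> nonempty_faces standard_simplex. \<Union>(\<Phi> S) homeomorphic S) \<and>
              (\<forall>S \<in> nonempty_faces standard_simplex. \<forall>T \<in> nonempty_faces standard_simplex.
                 \<Union>(\<Phi> S) \<inter> \<Union>(\<Phi> T) = (if S \<inter> T = {} then {} else \<Union>(\<Phi> (S \<inter> T)))))"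
proof -
  interpret coordinate_parallelepiped \<mu> \<nu>
    by unfold_locales (rule assms)
  let ?faces = "nonempty_faces (standard_simplex :: (real ^ 'n option) set)"
  have disk: "\<exists>d. (\<forall>F \<in> C. aff_dim F = int d) \<and> homeomorphic_to_disk d (\<Union>C)"
    if "C \<in> L_classes \<mu> \<nu>" for C
  proof -
    obtain S where S: "S \<noteq> {}" "C = cell S" using \<open>C \<in> _\<close> by (auto simp: L_classes_eq)
    let ?d = "card {k. normal_form S k = Star}"
    \<comment> \<open>This leaves room for a \<open>?d\<close>-dimensional subspace in the ambient
      space.\<close>
    have "?d \<le> DIM((real, 'n) vec)" by (simp add: card_mono)
    then have "homeomorphic_to_disk ?d (\<Union>C)"
      unfolding S(2) using card_Star_normal_form[OF S(1)]
      by (intro homeomorphic_to_diskI Union_cell_homeomorphic[OF S(1)]) auto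
    then show ?thesis using aff_dim_cell S by blast
  qed
  define \<Phi> where "\<Phi> T = cell (simplex_vertices T)" for T
  have \<Phi>: "\<Phi> (simplex_face K) = cell K" for K by (simp add: \<Phi>_def)
  have "bij_betw \<Phi> ?faces (L_classes \<mu> \<nu>)"
    unfolding bij_betw_def nonempty_faces_standard_simplex
  proof
    show "inj_on \<Phi> (simplex_face ` {K. K \<noteq> {}})"
      by (intro inj_onI) (auto simp: \<Phi> dest: inj_onD[OF inj_on_cell])
    show "\<Phi> ` simplex_face ` {K. K \<noteq> {}} = L_classes \<mu> \<nu>"
      by (simp add: L_classes_eq image_image \<Phi>)
  qed
  moreover have "\<Union>(\<Phi> S) homeomorphic S" if "S \<in> ?faces" for S
  proof -
    obtain K where "K \<noteq> {}" and S: "S = simplex_face K"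
      using \<open>S \<in> ?faces\<close> by (auto simp: nonempty_faces_standard_simplex)
    have "convex S" "compact S"
      unfolding S simplex_face_def by (auto intro: finite_imp_compact_convex_hull)
    then show ?thesis
      using \<open>K \<noteq> {}\<close> unfolding S \<Phi>
      by (intro Union_cell_homeomorphic) (simp_all add: aff_dim_simplex_face)
  qed
  moreover have "\<Union>(\<Phi> S) \<inter> \<Union>(\<Phi> T) = (if S \<inter> T = {} then {} else \<Union>(\<Phi> (S \<inter> T)))"
    if "S \<in> ?faces" "T \<in> ?faces" for S T
  proof -
    obtain K L where "S = simplex_face K" "T = simplex_face L"
      using \<open>S \<in> ?faces\<close> \<open>T \<in> ?faces\<close> unfolding nonempty_faces_standard_simplex by blast
    \<comment> \<open>For disjoint \<open>K\<close> and \<open>L\<close> both sides are empty, since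
      \<open>cell {}\<close> has empty union.\<close>
    then show ?thesis
      by (cases "K \<inter> L = {}") (simp_all only: simplex_face_Int \<Phi> Union_cell_Int
          simplex_face_eq_empty_iff Union_cell_empty if_True if_False simp_thms)
  qed
  ultimately show ?thesis using disk by blast
qed

end
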